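(* Let $\kappa \in \{2,3,4,\ldots,\omega,\omega_1\}$. If a function $g\colon \mathbb{N} \to \mathbb{N}$ has a $\kappa$-fold Diophantine representation, then there exists a positive integer $m$ such that $g(n) < f_{\kappa}(n)$ for every integer $n \geq m$.
   Context: $\mathbb{N}$ denotes the set of non-negative integers; $\omega$ is the least infinite cardinal and $\omega_1$ the least uncountable cardinal. For a positive integer $n$, let $E_n=\{x_k=1,\ x_i+x_j=x_k,\ x_i \cdot x_j=x_k\colon i,j,k \in \{1,\ldots,n\}\}$ (a set of equations in variables $x_1,\ldots,x_n$). A set $\mathcal{M} \subseteq \mathbb{N}^p$ has a $\kappa$-fold Diophantine representation if there is a polynomial $W$ with integer coefficients such that for all $(a_1,\ldots,a_p)\in\mathbb{N}^p$: $(a_1,\ldots,a_p) \in \mathcal{M}$ iff there exist $x_1,\ldots,x_m \in \mathbb{N}$ with $W(a_1,\ldots,a_p,x_1,\ldots,x_m)=0$, and moreover for all $a_1,\ldots,a_p \in \mathbb{N}$ the equation $W(a_1,\ldots,a_p,x_1,\ldots,x_m)=0$ has fewer than $\kappa$ solutions $(x_1,\ldots,x_m)\in\mathbb{N}^m$. A function $g\colon\mathbb{N}\to\mathbb{N}$ has a $\kappa$-fold Diophantine representation if its graph $\{(x,g(x))\colon x\in\mathbb{N}\}\subseteq\mathbb{N}^2$ does. For a positive integer $n$, $f_\kappa(n)$ denotes the smallest non-negative integer $b$ such that for each system $S \subseteq E_n$ which has a solution in non-negative integers $x_1,\ldots,x_n$ and which has fewer than $\kappa$ solutions in non-negative integers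 $x_1,\ldots,x_n$, there exists a solution of $S$ in non-negative integers not greater than $b$. *)

theory Defs
  imports Main "HOL-Library.FuncSet" "HOL-Library.Poly_Mapping"
begin

unbundle cardinal_syntax

text \<open>
  Cardinals are represented by well-orders, up to isomorphism, as in the library:
  \<^const>\<open>natLeq_on\<close> \<open>k\<close> is the finite cardinal \<open>k\<close>, \<^const>\<open>natLeq\<close> is \<open>\<omega>\<close>, and its
  cardinal successor is \<open>\<omega>\<^sub>1\<close>. Hence \<open>|A| <o \<kappa>\<close> says that \<open>A\<close> has fewer than \<open>\<kappa>\<close> elements.
\<close>

definition fold_cardinal :: "'k rel \<Rightarrow> bool" where
  "fold_cardinal \<kappa> \<longleftrightarrow>
     (\<exists>k\<ge>2. \<kappa> =o natLeq_on k) \<or> \<kappa> =o natLeq \<or> \<kappa> =o cardSuc natLeq"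

text \<open>
  An integer polynomial is a finitely supported map from monomials to coefficients, a monomial
  being a finitely supported map from variables \<open>0, 1, 2, \<dots>\<close> to exponents.
\<close>

type_synonym int_mpoly = "(nat \<Rightarrow>\<^sub>0 nat) \<Rightarrow>\<^sub>0 int"

definition mpoly_vars :: "int_mpoly \<Rightarrow> nat set" where
  "mpoly_vars W = (\<Union>t\<in>Poly_Mapping.keys W. Poly_Mapping.keys t)"

definition mpoly_eval :: "int_mpoly \<Rightarrow> nat list \<Rightarrow> int" where
  "mpoly_eval W xs =
     (\<Sum>t\<in>Poly_Mapping.keys W. Poly_Mapping.lookup W t *
        (\<Prod>v\<in>Poly_Mapping.keys t. int (xs ! v) ^ Poly_Mapping.lookup t v))"

text \<open>Elements of \<open>\<nat>\<^sup>p\<close> are lists of length \<open>p\<close>.\<close>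

definition dioph_repr :: "'k rel \<Rightarrow> nat \<Rightarrow> nat list set \<Rightarrow> bool" where
  "dioph_repr \<kappa> p M \<longleftrightarrow>
     M \<subseteq> {a. length a = p} \<and>
     (\<exists>m W. mpoly_vars W \<subseteq> {..<p + m} \<and>
        (\<forall>a. length a = p \<longrightarrow>
           (a \<in> M \<longleftrightarrow> (\<exists>x. length x = m \<and> mpoly_eval W (a @ x) = 0))) \<and>
        (\<forall>a. length a = p \<longrightarrow>
           |{x. length x = m \<and> mpoly_eval W (a @ x) = 0}| <o \<kappa>))"

definition fun_dioph_repr :: "'k rel \<Rightarrow> (nat \<Rightarrow> nat) \<Rightarrow> bool" where
  "fun_dioph_repr \<kappa> g \<longleftrightarrow> dioph_repr \<kappa> 2 {[x, g x] | x. True}"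

text \<open>
  \<open>EqOne k\<close>, \<open>EqAdd i j k\<close> and \<open>EqMult i j k\<close> stand for the equations \<open>x\<^sub>k = 1\<close>,
  \<open>x\<^sub>i + x\<^sub>j = x\<^sub>k\<close> and \<open>x\<^sub>i \<cdot> x\<^sub>j = x\<^sub>k\<close>.
\<close>

datatype equation = EqOne nat | EqAdd nat nat nat | EqMult nat nat nat

fun satisfies :: "(nat \<Rightarrow> nat) \<Rightarrow> equation \<Rightarrow> bool" where
  "satisfies x (EqOne k) \<longleftrightarrow> x k = 1"
| "satisfies x (EqAdd i j k) \<longleftrightarrow> x i + x j = x k"
| "satisfies x (EqMult i j k) \<longleftrightarrow> x i * x j = x k"

definition E_sys :: "nat \<Rightarrow> equation set" where
  "E_sys n = {EqOne k | k. k \<in> {1..n}}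
       \<union> {EqAdd i j k | i j k. i \<in> {1..n} \<and> j \<in> {1..n} \<and> k \<in> {1..n}}
       \<union> {EqMult i j k | i j k. i \<in> {1..n} \<and> j \<in> {1..n} \<and> k \<in> {1..n}}"

text \<open>
  Assignments are extensional functions on \<open>{1..n}\<close>, so that each \<open>n\<close>-tuple is counted once.
\<close>

definition solutions :: "nat \<Rightarrow> equation set \<Rightarrow> (nat \<Rightarrow> nat) set" where
  "solutions n S = {x \<in> {1..n} \<rightarrow>\<^sub>E UNIV. \<forall>e\<in>S. satisfies x e}"

definition solution_bound :: "'k rel \<Rightarrow> nat \<Rightarrow> nat \<Rightarrow> bool" where
  "solution_bound \<kappa> n b \<longleftrightarrow>
     (\<forall>S \<subseteq> E_sys n. solutions n S \<noteq> {} \<and> |solutions n S| <o \<kappa> \<longrightarrow>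
        (\<exists>x \<in> solutions n S. \<forall>i\<in>{1..n}. x i \<le> b))"

definition f_kappa :: "'k rel \<Rightarrow> nat \<Rightarrow> nat" where
  "f_kappa \<kappa> n = (LEAST b. solution_bound \<kappa> n b)"

lemma finite_E_sys: "finite (E_sys n)"
proof -
  have "E_sys n \<subseteq> EqOne ` {1..n}
     \<union> (\<lambda>(i, j, k). EqAdd i j k) ` ({1..n} \<times> {1..n} \<times> {1..n})
     \<union> (\<lambda>(i, j, k). EqMult i j k) ` ({1..n} \<times> {1..n} \<times> {1..n})"
    by (auto simp: E_sys_def image_iff)
  then show ?thesis
    by (rule finite_subset) auto
qed

text \<open>The minimum defining \<open>f_kappa\<close> is attained, so \<^const>\<open>Least\<close> is not underspecified here.\<close>

lemma solution_bound_f_kappa: "solution_bound \<kappa> n (f_kappa \<kappa> n)"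
proof -
  define y where "y S = (SOME x. x \<in> solutions n S)" for S
  define B where "B = (\<lambda>(S, i). y S i) ` (Pow (E_sys n) \<times> {1..n})"
  have fin: "finite B"
    by (simp add: B_def finite_E_sys)
  have "solution_bound \<kappa> n (Max (insert 0 B))"
    unfolding solution_bound_def
  proof (intro allI impI, elim conjE)
    fix S assume S: "S \<subseteq> E_sys n" "solutions n S \<noteq> {}"
    have "y S \<in> solutions n S"
      using S(2) by (simp add: y_def some_in_eq)
    moreover have "y S i \<le> Max (insert 0 B)" if "i \<in> {1..n}" for i
    proof -
      have "(S, i) \<in> Pow (E_sys n) \<times> {1..n}"
        using S(1) that by blast
      then have "y S i \<in> B"
        unfolding B_def by (rule rev_image_eqI) simp
      then show ?thesis
        using fin by simp
    qed
    ultimately show "\<exists>x \<in> solutions n S. \<forall>i\<in>{1..n}. x i \<le> Max (insert 0 B)"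
      by blast
  qed
  then show ?thesis
    unfolding f_kappa_def by (rule LeastI)
qed

end

theory Submission
  imports Defs
begin

text \<open>
  Write the representing polynomial as \<open>W = P - N\<close>, where \<open>P\<close> and \<open>N\<close> are built from \<open>1\<close> and the
  variables by sums and products, and where \<open>P(x, y, \<dots>) > y\<close>. Evaluating \<open>P\<close> and \<open>N\<close> gate by gate
  takes a number \<open>C\<close> of variables that does not depend on \<open>n\<close>, and the auxiliary variables are
  uniquely determined by the inputs. The remaining \<open>n - C\<close> variables are forced to be
  \<open>1, 2, \<dots>, n - C\<close>. As soon as \<open>n - C \<ge> \<lceil>n/2\<rceil>\<close>, one more addition
  \<open>\<lfloor>n/2\<rfloor> + \<lceil>n/2\<rceil>\<close> forces the first argument to be \<open>n\<close>. The resulting system in \<open>n\<close> variables has as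
  many solutions as \<open>W(n, g(n), \<dots>) = 0\<close>, and in each of them the variable holding \<open>P\<close>
  exceeds \<open>g(n)\<close>.
\<close>

section \<open>Integer polynomials as differences of subtraction-free ones\<close>

inductive pos_poly :: "nat \<Rightarrow> (nat list \<Rightarrow> nat) \<Rightarrow> bool" for k where
  one: "pos_poly k (\<lambda>_. 1)"
| var: "v < k \<Longrightarrow> pos_poly k (\<lambda>xs. xs ! v)"
| add: "pos_poly k f \<Longrightarrow> pos_poly k g \<Longrightarrow> pos_poly k (\<lambda>xs. f xs + g xs)"
| mult: "pos_poly k f \<Longrightarrow> pos_poly k g \<Longrightarrow> pos_poly k (\<lambda>xs. f xs * g xs)"

text \<open>Constants start at 1: the zero function is out of reach, as every generated function is
  positive when all inputs are 1.\<close>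

lemma pos_poly_Suc_const: "pos_poly k (\<lambda>_. Suc c)"
proof (induction c)
  case 0
  show ?case using pos_poly.one by simp
next
  case (Suc c)
  from pos_poly.add[OF Suc pos_poly.one] show ?case by simp
qed

lemma pos_poly_power: "pos_poly k f \<Longrightarrow> pos_poly k (\<lambda>xs. f xs ^ e)"
  by (induction e) (auto intro: pos_poly.intros pos_poly.one[simplified])

lemma pos_poly_prod:
  "finite A \<Longrightarrow> (\<And>v. v \<in> A \<Longrightarrow> pos_poly k (f v)) \<Longrightarrow> pos_poly k (\<lambda>xs. \<Prod>v\<in>A. f v xs)"
  by (induction A rule: finite_induct) (auto intro: pos_poly.intros pos_poly.one[simplified])

lemma sum_monomials_diff_pos_poly:
  assumes "finite T" "\<And>t. t \<in> T \<Longrightarrow> Poly_Mapping.keys t \<subseteq> {..<k}"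
  shows "\<exists>P N. pos_poly k P \<and> pos_poly k N \<and>
    (\<forall>xs. (\<Sum>t\<in>T. c t * (\<Prod>v\<in>Poly_Mapping.keys t. int (xs ! v) ^ Poly_Mapping.lookup t v))
       = int (P xs) - int (N xs))"
  using assms
proof (induction T rule: finite_induct)
  case empty
  show ?case by (intro exI[of _ "\<lambda>_. 1"]) (auto intro: pos_poly.one[simplified])
next
  case (insert t T)
  then obtain P N where PN: "pos_poly k P" "pos_poly k N"
    "\<And>xs. (\<Sum>t\<in>T. c t * (\<Prod>v\<in>Poly_Mapping.keys t. int (xs ! v) ^ Poly_Mapping.lookup t v))
       = int (P xs) - int (N xs)"
    by auto
  define M where "M xs = (\<Prod>v\<in>Poly_Mapping.keys t. (xs ! v) ^ Poly_Mapping.lookup t v)"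
    for xs :: "nat list"
  have M: "pos_poly k M"
    unfolding M_def using insert.prems[of t]
    by (intro pos_poly_prod pos_poly_power pos_poly.var) auto
  have int_M: "(\<Prod>v\<in>Poly_Mapping.keys t. int (xs ! v) ^ Poly_Mapping.lookup t v) = int (M xs)"
    for xs by (simp add: M_def)
  have c: "c t = int (nat (c t)) - int (nat (- c t))" by simp
  show ?case
    \<comment> \<open>The coefficient is split into positive and negative parts; both
      \<open>Suc\<close> keep the factors nonzero, and the extra copies of \<open>M xs\<close>
      cancel in the difference.\<close>
    apply (rule exI[of _ "\<lambda>xs. P xs + Suc (nat (c t)) * M xs"])
    apply (rule exI[of _ "\<lambda>xs. N xs + Suc (nat (- c t)) * M xs"])
    apply (intro conjI allI pos_poly.add pos_poly.mult PN(1,2) M pos_poly_Suc_const)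
    apply (simp only: sum.insert[OF insert.hyps] int_M PN(3))
    apply (subst c)
    apply (simp only: of_nat_add of_nat_mult of_nat_Suc)
    apply (simp only: algebra_simps)
    done
qed

lemma mpoly_eval_diff_pos_poly:
  assumes "mpoly_vars W \<subseteq> {..<k}"
  obtains P N where "pos_poly k P" "pos_poly k N"
    "\<And>xs. mpoly_eval W xs = int (P xs) - int (N xs)"
proof -
  have "Poly_Mapping.keys t \<subseteq> {..<k}" if "t \<in> Poly_Mapping.keys W" for t
    using assms that by (auto simp: mpoly_vars_def)
  from sum_monomials_diff_pos_poly[OF finite_keys this, of W "Poly_Mapping.lookup W"] that
  show ?thesis by (auto simp: mpoly_eval_def)
qed

section \<open>Systems of equations that determine their own variables\<close>

definition inputs :: "nat \<Rightarrow> (nat \<Rightarrow> nat) \<Rightarrow> nat list" where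
  "inputs k x = map (\<lambda>v. x (Suc v)) [0..<k]"

lemma length_inputs [simp]: "length (inputs k x) = k"
  by (simp add: inputs_def)

lemma nth_inputs [simp]: "v < k \<Longrightarrow> inputs k x ! v = x (Suc v)"
  by (simp add: inputs_def)

text \<open>
  The system \<open>S\<close> pins down exactly the variables \<open>s + 1, \<dots>, C\<close>, with values given by \<open>h\<close> in terms
  of the inputs \<open>1, \<dots>, k\<close>. The variables up to \<open>s\<close> that are not inputs may already be in use by
  another such system.
\<close>

definition computes ::
  "nat \<Rightarrow> nat \<Rightarrow> nat \<Rightarrow> equation set \<Rightarrow> (nat \<Rightarrow> nat list \<Rightarrow> nat) \<Rightarrow> nat \<Rightarrow> (nat list \<Rightarrow> nat) \<Rightarrow> bool"
  where
  "computes k s C S h r f \<longleftrightarrow>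
     s \<le> C \<and> S \<subseteq> E_sys C \<and> r \<in> {1..C} \<and>
     (\<forall>x. (\<forall>e\<in>S. satisfies x e) \<longleftrightarrow> (\<forall>i\<in>{s<..C}. x i = h i (inputs k x))) \<and>
     (\<forall>x. (\<forall>e\<in>S. satisfies x e) \<longrightarrow> x r = f (inputs k x))"

lemma E_sys_mono: "m \<le> n \<Longrightarrow> E_sys m \<subseteq> E_sys n"
  unfolding E_sys_def by fastforce

text \<open>The two blocks of variables are disjoint and adjacent, and both are functions of the
  inputs alone, so joining the systems imposes no condition on the inputs.\<close>

lemma computes_Un:
  assumes "computes k s C1 S1 h1 r1 f1" "computes k C1 C2 S2 h2 r2 f2"
  shows "(\<forall>e\<in>S1 \<union> S2. satisfies x e) \<longleftrightarrow>
    (\<forall>i\<in>{s<..C2}. x i = (if i \<le> C1 then h1 i else h2 i) (inputs k x))"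
proof -
  have "{s<..C2} = {s<..C1} \<union> {C1<..C2}"
    using assms by (auto simp: computes_def)
  moreover have "(\<forall>e\<in>S1 \<union> S2. satisfies x e) \<longleftrightarrow>
      (\<forall>i\<in>{s<..C1}. x i = h1 i (inputs k x)) \<and> (\<forall>i\<in>{C1<..C2}. x i = h2 i (inputs k x))"
    using assms unfolding computes_def ball_Un by blast
  ultimately show ?thesis
    by (simp add: ball_Un)
qed

text \<open>Treats sums and products at once: the gate writes into the fresh variable
  \<open>Suc C2\<close>, whose value is forced because both operands are.\<close>

lemma computes_gate:
  assumes f: "computes k s C1 S1 h1 r1 f1" and g: "computes k C1 C2 S2 h2 r2 f2"
    and G: "\<And>x i j c. satisfies x (G i j c) \<longleftrightarrow> op (x i) (x j) = x c"
    and G_E: "\<And>i j c n. i \<in> {1..n} \<Longrightarrow> j \<in> {1..n} \<Longrightarrow> c \<in> {1..n} \<Longrightarrow> G i j c \<in> E_sys n"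
  shows "computes k s (Suc C2) (insert (G r1 r2 (Suc C2)) (S1 \<union> S2))
    (\<lambda>i xs. if i \<le> C2 then (if i \<le> C1 then h1 i else h2 i) xs else op (f1 xs) (f2 xs)) (Suc C2)
    (\<lambda>xs. op (f1 xs) (f2 xs))"
proof -
  have bounds: "s \<le> C1" "C1 \<le> C2" "r1 \<in> {1..Suc C2}" "r2 \<in> {1..Suc C2}"
    using f g by (auto simp: computes_def)
  have sub: "S1 \<subseteq> E_sys (Suc C2)" "S2 \<subseteq> E_sys (Suc C2)"
    using f g bounds E_sys_mono[of C1 "Suc C2"] E_sys_mono[of C2 "Suc C2"]
    by (auto simp: computes_def)
  have r: "x r1 = f1 (inputs k x) \<and> x r2 = f2 (inputs k x)"
    if "\<forall>e\<in>S1 \<union> S2. satisfies x e" for x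
    using f g that unfolding computes_def ball_Un by blast
  have eq: "{s<..Suc C2} = insert (Suc C2) {s<..C2}"
    using bounds by auto
  show ?thesis
    unfolding computes_def
  proof (intro conjI allI)
    show "s \<le> Suc C2" "Suc C2 \<in> {1..Suc C2}" using bounds by auto
    show "insert (G r1 r2 (Suc C2)) (S1 \<union> S2) \<subseteq> E_sys (Suc C2)"
      using sub G_E[OF bounds(3,4)] by auto
    fix x
    show "(\<forall>e\<in>insert (G r1 r2 (Suc C2)) (S1 \<union> S2). satisfies x e) \<longrightarrow>
        x (Suc C2) = op (f1 (inputs k x)) (f2 (inputs k x))"
      using r[of x] by (auto simp: G)
    have "(\<forall>e\<in>insert (G r1 r2 (Suc C2)) (S1 \<union> S2). satisfies x e) \<longleftrightarrow>
        x (Suc C2) = op (f1 (inputs k x)) (f2 (inputs k x)) \<and> (\<forall>e\<in>S1 \<union> S2. satisfies x e)"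
      using r[of x] by (auto simp: G)
    then show "(\<forall>e\<in>insert (G r1 r2 (Suc C2)) (S1 \<union> S2). satisfies x e) \<longleftrightarrow>
        (\<forall>i\<in>{s<..Suc C2}. x i = (if i \<le> C2 then (if i \<le> C1 then h1 i else h2 i) (inputs k x)
           else op (f1 (inputs k x)) (f2 (inputs k x))))"
      unfolding computes_Un[OF f g] eq by auto
  qed
qed

text \<open>The start \<open>s\<close> stays arbitrary in the induction, so that the second operand
  can be evaluated in variables beyond those used for the first.\<close>

lemma pos_poly_computes:
  assumes "pos_poly k f" "k \<le> s"
  shows "\<exists>C S h r. computes k s C S h r f"
  using assms
proof (induction arbitrary: s rule: pos_poly.induct)
  case one
  have "{s<..Suc s} = {Suc s}" by auto
  then have "computes k s (Suc s) {EqOne (Suc s)} (\<lambda>_ _. 1) (Suc s) (\<lambda>_. 1)"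
    by (simp add: computes_def E_sys_def)
  then show ?case by blast
next
  case (var v)
  \<comment> \<open>An input is its own output; the block is empty, so the value 0 is a
    dummy.\<close>
  then have "computes k s s {} (\<lambda>_ _. 0) (Suc v) (\<lambda>xs. xs ! v)"
    by (simp add: computes_def)
  then show ?case by blast
next
  case (add f g)
  then obtain C1 S1 h1 r1 where f: "computes k s C1 S1 h1 r1 f" by blast
  moreover from f add.prems have "k \<le> C1" by (simp add: computes_def)
  with add.IH(2) obtain C2 S2 h2 r2 where "computes k C1 C2 S2 h2 r2 g" by blast
  ultimately show ?case
    using computes_gate[of k s C1 S1 h1 r1 f C2 S2 h2 r2 g EqAdd "(+)"]
    by (fastforce simp: E_sys_def)
next
  case (mult f g)
  then obtain C1 S1 h1 r1 where f: "computes k s C1 S1 h1 r1 f" by blast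
  moreover from f mult.prems have "k \<le> C1" by (simp add: computes_def)
  with mult.IH(2) obtain C2 S2 h2 r2 where "computes k C1 C2 S2 h2 r2 g" by blast
  ultimately show ?case
    using computes_gate[of k s C1 S1 h1 r1 f C2 S2 h2 r2 g EqMult "(*)"]
    by (fastforce simp: E_sys_def)
qed

text \<open>Occupies every variable after \<open>C\<close>, so that none stays free to multiply the
  solutions, and at the same time supplies the constants needed to name \<open>n\<close>.\<close>

definition counting_chain :: "nat \<Rightarrow> nat \<Rightarrow> equation set" where
  "counting_chain C n =
     insert (EqOne (C + 1)) {EqAdd (C + 1) (C + i) (C + Suc i) | i. 1 \<le> i \<and> C + i < n}"

lemma satisfies_counting_chain:
  assumes "C < n"
  shows "(\<forall>e\<in>counting_chain C n. satisfies x e) \<longleftrightarrow> (\<forall>i\<in>{C<..n}. x i = i - C)"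
proof
  assume L: "\<forall>e\<in>counting_chain C n. satisfies x e"
  have "Suc i \<le> n - C \<Longrightarrow> x (C + Suc i) = Suc i" for i
  proof (induction i)
    case 0
    show ?case using L by (simp add: counting_chain_def)
  next
    case (Suc i)
    have "satisfies x (EqAdd (C + 1) (C + Suc i) (C + Suc (Suc i)))"
      using L Suc.prems unfolding counting_chain_def by fastforce
    moreover have "x (C + 1) = 1"
      using L by (simp add: counting_chain_def)
    moreover have "x (C + Suc i) = Suc i"
      using Suc by linarith
    ultimately show ?case
      unfolding satisfies.simps by linarith
  qed
  then show "\<forall>i\<in>{C<..n}. x i = i - C"
    by (metis Suc_diff_Suc diff_le_mono greaterThanAtMost_iff le_add_diff_inverse less_imp_le_nat)
next
  assume "\<forall>i\<in>{C<..n}. x i = i - C"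
  then show "\<forall>e\<in>counting_chain C n. satisfies x e"
    using assms by (auto simp: counting_chain_def)
qed

lemma counting_chain_subset: "C < n \<Longrightarrow> counting_chain C n \<subseteq> E_sys n"
  by (auto simp: counting_chain_def E_sys_def)

theorem theorem5:
  fixes \<kappa> :: "'k rel" and g :: "nat \<Rightarrow> nat"
  assumes "fold_cardinal \<kappa>"
    and "fun_dioph_repr \<kappa> g"
  shows "\<exists>m>0. \<forall>n\<ge>m. g n < f_kappa \<kappa> n"
proof -
  obtain m W where vars: "mpoly_vars W \<subseteq> {..<2 + m}"
    and graph: "\<And>a. length a = 2 \<Longrightarrow>
      a \<in> {[x, g x] | x. True} \<longleftrightarrow> (\<exists>x. length x = m \<and> mpoly_eval W (a @ x) = 0)"
    and few: "\<And>a. length a = 2 \<Longrightarrow> |{x. length x = m \<and> mpoly_eval W (a @ x) = 0}| <o \<kappa>"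
    using assms(2) unfolding fun_dioph_repr_def dioph_repr_def by blast
  define k where "k = 2 + m"
  obtain P0 N0 where PN0: "pos_poly k P0" "pos_poly k N0"
    "\<And>xs. mpoly_eval W xs = int (P0 xs) - int (N0 xs)"
    using mpoly_eval_diff_pos_poly vars unfolding k_def by blast
  \<comment> \<open>Adding the same term on both sides preserves the difference; position 1 of the
    list will hold \<open>g n\<close>.\<close>
  define P where "P = (\<lambda>xs. P0 xs + (1 + xs ! 1))"
  define N where "N = (\<lambda>xs. N0 xs + (1 + xs ! 1))"
  have "pos_poly k P" "pos_poly k N"
    unfolding P_def N_def by (intro pos_poly.intros PN0; simp add: k_def)+
  then obtain C1 S1 h1 r1 C S2 h2 r2 where P: "computes k k C1 S1 h1 r1 P"
    and N: "computes k C1 C S2 h2 r2 N"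
    by (metis computes_def order_refl pos_poly_computes)
  have eval_0: "mpoly_eval W xs = 0 \<longleftrightarrow> P xs = N xs" for xs
    by (simp add: PN0(3) P_def N_def)
  have P_gt: "xs ! 1 < P xs" for xs by (simp add: P_def)
  define h where "h = (\<lambda>i. if i \<le> C1 then h1 i else h2 i)"
  have bounds: "k \<le> C" "r1 \<in> {1..C}" "r2 \<in> {1..C}" "C1 \<le> C"
    using P N by (auto simp: computes_def)
  have sat: "(\<forall>e\<in>S1 \<union> S2. satisfies x e) \<longleftrightarrow> (\<forall>i\<in>{k<..C}. x i = h i (inputs k x))" for x
    using computes_Un[OF P N] by (simp add: h_def)
  have outs: "x r1 = P (inputs k x) \<and> x r2 = N (inputs k x)"
    if "\<forall>e\<in>S1 \<union> S2. satisfies x e" for x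
    using P N that unfolding computes_def ball_Un by blast
  have main: "g n < f_kappa \<kappa> n" if n: "n \<ge> 2 * C + 2" for n
  proof -
    \<comment> \<open>No equation of the form \<open>x i = x j\<close> is available, so
      \<open>P = N\<close> is stated as a product with variable \<open>C + 1\<close>, which the
      chain sets to 1.\<close>
    define S where "S = S1 \<union> S2 \<union> counting_chain C n \<union>
      {EqAdd (C + n div 2) (C + (n - n div 2)) 1, EqMult (C + 1) r1 r2}"
    have "C < n" and half: "1 \<le> n div 2" "C + n div 2 \<le> n" "C + (n - n div 2) \<le> n"
      using n by auto
    have "S1 \<subseteq> E_sys n" "S2 \<subseteq> E_sys n"
      using P N bounds E_sys_mono[of C1 n] E_sys_mono[of C n] \<open>C < n\<close>
      by (auto simp: computes_def)
    moreover have "EqAdd (C + n div 2) (C + (n - n div 2)) 1 \<in> E_sys n"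
      "EqMult (C + 1) r1 r2 \<in> E_sys n"
      using half bounds \<open>C < n\<close> by (auto simp: E_sys_def)
    ultimately have S_E: "S \<subseteq> E_sys n"
      unfolding S_def using counting_chain_subset[OF \<open>C < n\<close>] by blast
    have sat_S: "(\<forall>e\<in>S. satisfies x e) \<longleftrightarrow>
      (\<forall>i\<in>{k<..C}. x i = h i (inputs k x)) \<and> (\<forall>i\<in>{C<..n}. x i = i - C) \<and>
      x 1 = n \<and> mpoly_eval W (inputs k x) = 0" for x
    proof -
      have "(\<forall>e\<in>S. satisfies x e) \<longleftrightarrow>
        (\<forall>e\<in>S1 \<union> S2. satisfies x e) \<and> (\<forall>i\<in>{C<..n}. x i = i - C) \<and>
        x (C + n div 2) + x (C + (n - n div 2)) = x 1 \<and> x (C + 1) * x r1 = x r2"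
        unfolding S_def ball_Un satisfies_counting_chain[OF \<open>C < n\<close>, symmetric] by auto
      moreover have "x (C + n div 2) + x (C + (n - n div 2)) = n \<and> x (C + 1) = 1"
        if "\<forall>i\<in>{C<..n}. x i = i - C"
      proof -
        have "x (C + n div 2) = n div 2" "x (C + (n - n div 2)) = n - n div 2" "x (C + 1) = 1"
          using bspec[OF that, of "C + n div 2"] bspec[OF that, of "C + (n - n div 2)"]
            bspec[OF that, of "C + 1"] half \<open>C < n\<close> by auto
        then show ?thesis by linarith
      qed
      moreover have "x r1 = x r2 \<longleftrightarrow> mpoly_eval W (inputs k x) = 0"
        if "\<forall>e\<in>S1 \<union> S2. satisfies x e"
        using outs[OF that] by (simp add: eval_0)
      ultimately show ?thesis
        unfolding sat[symmetric] by (metis mult_1)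
    qed
    have inputs_eq: "inputs k x = [n, g n] @ drop 2 (inputs k x)"
      and tail: "drop 2 (inputs k x) \<in> {xs. length xs = m \<and> mpoly_eval W ([n, g n] @ xs) = 0}"
      if "x \<in> solutions n S" for x
    proof -
      have x: "x 1 = n" "mpoly_eval W (inputs k x) = 0"
        using that sat_S by (auto simp: solutions_def)
      have split: "inputs k x = [x 1, x 2] @ drop 2 (inputs k x)"
        by (rule nth_equalityI) (auto simp: k_def nth_Cons numeral_2_eq_2 split: nat.split)
      have len: "length (drop 2 (inputs k x)) = m"
        by (simp add: k_def)
      have eval: "mpoly_eval W ([x 1, x 2] @ drop 2 (inputs k x)) = 0"
        using x(2) by (simp only: split[symmetric])
      \<comment> \<open>The system fixes only the first argument; the zero of \<open>W\<close> puts
        the pair on the graph and so forces the second.\<close>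
      have "[x 1, x 2] \<in> {[x, g x] | x. True}"
        by (subst graph) (simp, use eval len in blast)
      then have "x 2 = g n"
        using x(1) by auto
      then have pair: "[x 1, x 2] = [n, g n]"
        using x(1) by simp
      show "inputs k x = [n, g n] @ drop 2 (inputs k x)"
        using split unfolding pair .
      show "drop 2 (inputs k x) \<in> {xs. length xs = m \<and> mpoly_eval W ([n, g n] @ xs) = 0}"
        using eval len unfolding pair by blast
    qed
    have det: "(\<forall>i\<in>{k<..C}. x i = h i (inputs k x)) \<and> (\<forall>i\<in>{C<..n}. x i = i - C)"
      if "x \<in> solutions n S" for x
      using that sat_S[of x] unfolding solutions_def by blast
    \<comment> \<open>The tail restores all inputs, and these determine the remaining variables by
      \<open>det\<close>; thus \<open>S\<close> has no more solutions than the equation for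
      \<open>W\<close> at \<open>[n, g n]\<close>.\<close>
    have "inj_on (\<lambda>x. drop 2 (inputs k x)) (solutions n S)"
    proof (rule inj_onI)
      fix x y assume xy: "x \<in> solutions n S" "y \<in> solutions n S"
        "drop 2 (inputs k x) = drop 2 (inputs k y)"
      then have inp: "inputs k x = inputs k y"
        using inputs_eq by metis
      have "x i = y i" if "i \<in> {1..n}" for i
      proof -
        consider "i \<le> k" | "i \<in> {k<..C}" | "i \<in> {C<..n}"
          using \<open>i \<in> {1..n}\<close> by force
        then show ?thesis
        proof cases
          case 1
          then show ?thesis
            using arg_cong[OF inp, of "\<lambda>xs. xs ! (i - 1)"] that by (cases i) auto
        next
          case 2
          then show ?thesis using det[OF xy(1)] det[OF xy(2)] inp by metis
        next
          case 3
          then show ?thesis using det[OF xy(1)] det[OF xy(2)] by metis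
        qed
      qed
      then show "x = y"
        using xy(1,2) unfolding solutions_def
        by (intro PiE_ext[of x "{1..n}" "\<lambda>_. UNIV" y]) blast+
    qed
    then have "|solutions n S| \<le>o |{xs. length xs = m \<and> mpoly_eval W ([n, g n] @ xs) = 0}|"
      using tail by (intro card_of_ordLeqI) auto
    then have small: "|solutions n S| <o \<kappa>"
      by (rule ordLeq_ordLess_trans[OF _ few]) simp
    have "solutions n S \<noteq> {}"
    proof -
      obtain xs where xs: "length xs = m" "mpoly_eval W ([n, g n] @ xs) = 0"
        using graph[of "[n, g n]"] by auto
      define a where "a = [n, g n] @ xs"
      \<comment> \<open>Inputs sit at \<open>i - 1\<close> in the list; \<open>undefined\<close>
        outside \<open>{1..n}\<close> makes the assignment extensional.\<close>
      define x where "x i = (if i \<in> {1..k} then a ! (i - 1) else if i \<in> {k<..C} then h i a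
        else if i \<in> {C<..n} then i - C else undefined)" for i
      have "inputs k x = a"
        by (rule nth_equalityI) (auto simp: k_def a_def x_def xs)
      moreover have "x 1 = n"
        by (simp add: x_def a_def k_def)
      ultimately have "\<forall>e\<in>S. satisfies x e"
        using xs bounds by (auto simp: sat_S x_def a_def)
      moreover have "x \<in> {1..n} \<rightarrow>\<^sub>E UNIV"
        using bounds \<open>C < n\<close> by (auto simp: x_def)
      ultimately show ?thesis
        by (auto simp: solutions_def)
    qed
    \<comment> \<open>Some solution of \<open>S\<close> is bounded by
      \<open>f_kappa \<kappa> n\<close>, yet its variable \<open>r1\<close> exceeds
      \<open>g n\<close>.\<close>
    with small S_E solution_bound_f_kappa[of \<kappa> n] obtain x where
      x: "x \<in> solutions n S" "\<forall>i\<in>{1..n}. x i \<le> f_kappa \<kappa> n"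
      unfolding solution_bound_def by blast
    have "g n = inputs k x ! 1"
      by (subst inputs_eq[OF x(1)]) simp
    also have "\<dots> < P (inputs k x)"
      by (rule P_gt)
    also have "\<dots> = x r1"
      using outs[of x] x(1) by (auto simp: solutions_def S_def)
    also have "\<dots> \<le> f_kappa \<kappa> n"
      using x(2) bounds(2) \<open>C < n\<close> by auto
    finally show ?thesis .
  qed
  show ?thesis
    by (rule exI[of _ "2 * C + 2"]) (use main in auto)
qed

end
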